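(* Let $I$ be a finite set and $n=|I|$. The normal equivalence classes of orbit polytopes $\mathcal{O}(p)$ for $p\in\mathbb{R}I$ are in bijection with the compositions of the integer $n$.
   Context: $\mathbb{R}I$ is the real vector space with basis $\{e_i:i\in I\}$ and $\mathbb{R}^I$ its dual space. The group $\mathfrak{S}_I$ of permutations of $I$ acts on $\mathbb{R}I$ by $\sigma(p)_i=p_{\sigma^{-1}(i)}$. The orbit polytope of $p\in\mathbb{R}I$ is $\mathcal{O}(p)=\operatorname{conv}\{\sigma(p):\sigma\in\mathfrak{S}_I\}$. For a face $F$ of a polytope $P\subset\mathbb{R}I$, the normal cone $\mathcal{N}_P(F)$ is the cone of all $y\in\mathbb{R}^I$ attaining their maximum value over $P$ at every point of $F$; the normal fan of $P$ is $\mathcal{N}_P=\{\mathcal{N}_P(F):F\le P\}$; polytopes $P,Q$ are normally equivalent if $\mathcal{N}_P=\mathcal{N}_Q$. A composition of $n$ is a finite sequence of positive integers with sum $n$ (the empty sequence being the unique composition of $0$). *)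

theory Defs
  imports "HOL-Analysis.Analysis" "HOL-Analysis.Finite_Function_Topology"
begin

(* The real vector space with basis I, as the finitely supported functions vanishing outside I;
   the basis vector e_i is Poly_Mapping.single i 1. *)
definition free_space :: "'a set \<Rightarrow> ('a \<Rightarrow>\<^sub>0 real) set" where
  "free_space I = {p. Poly_Mapping.keys p \<subseteq> I}"

(* For finite I, a linear functional on free_space I is given by its values on the basis, so the
   dual space consists of the functions on I, extensional so that each functional occurs once. *)
definition dual_space :: "'a set \<Rightarrow> ('a \<Rightarrow> real) set" where
  "dual_space I = I \<rightarrow>\<^sub>E UNIV"

definition pairing :: "'a set \<Rightarrow> ('a \<Rightarrow> real) \<Rightarrow> ('a \<Rightarrow>\<^sub>0 real) \<Rightarrow> real" where
  "pairing I y p = (\<Sum>i\<in>I. y i * Poly_Mapping.lookup p i)"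

definition perm_act :: "('a \<Rightarrow> 'a) \<Rightarrow> ('a \<Rightarrow>\<^sub>0 real) \<Rightarrow> ('a \<Rightarrow>\<^sub>0 real)" where
  "perm_act \<sigma> p = Poly_Mapping.map_key (inv \<sigma>) p"

(* Poly_Mapping.map_key is only specified for injective maps. *)
lemma lookup_perm_act:
  assumes "\<sigma> permutes I"
  shows "Poly_Mapping.lookup (perm_act \<sigma> p) i = Poly_Mapping.lookup p (inv \<sigma> i)"
proof -
  have "inj (inv \<sigma>)"
    using assms by (meson permutes_inj permutes_inv)
  then show ?thesis
    by (simp add: perm_act_def map_key.rep_eq)
qed

definition orbit_polytope :: "'a set \<Rightarrow> ('a \<Rightarrow>\<^sub>0 real) \<Rightarrow> ('a \<Rightarrow>\<^sub>0 real) set" where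
  "orbit_polytope I p = convex hull {perm_act \<sigma> p |\<sigma>. \<sigma> permutes I}"

definition normal_cone ::
    "'a set \<Rightarrow> ('a \<Rightarrow>\<^sub>0 real) set \<Rightarrow> ('a \<Rightarrow>\<^sub>0 real) set \<Rightarrow> ('a \<Rightarrow> real) set" where
  "normal_cone I P F =
     {y \<in> dual_space I. \<forall>x\<in>F. \<forall>z\<in>P. pairing I y z \<le> pairing I y x}"

(* face_of also admits the empty face, which has no normal cone in the fan. *)
definition normal_fan :: "'a set \<Rightarrow> ('a \<Rightarrow>\<^sub>0 real) set \<Rightarrow> ('a \<Rightarrow> real) set set" where
  "normal_fan I P = {normal_cone I P F |F. F face_of P \<and> F \<noteq> {}}"

definition normally_equivalent ::
    "'a set \<Rightarrow> ('a \<Rightarrow>\<^sub>0 real) set \<Rightarrow> ('a \<Rightarrow>\<^sub>0 real) set \<Rightarrow> bool" where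
  "normally_equivalent I P Q \<longleftrightarrow> normal_fan I P = normal_fan I Q"

definition orbit_polytopes :: "'a set \<Rightarrow> ('a \<Rightarrow>\<^sub>0 real) set set" where
  "orbit_polytopes I = orbit_polytope I ` free_space I"

definition orbit_polytope_classes :: "'a set \<Rightarrow> ('a \<Rightarrow>\<^sub>0 real) set set set" where
  "orbit_polytope_classes I =
     orbit_polytopes I //
       {(P, Q). P \<in> orbit_polytopes I \<and> Q \<in> orbit_polytopes I \<and> normally_equivalent I P Q}"

definition compositions :: "nat \<Rightarrow> nat list set" where
  "compositions n = {c. (\<forall>k\<in>set c. 0 < k) \<and> sum_list c = n}"

end

theory Submission
  imports Defs "HOL-Combinatorics.Permutations"
begin

text \<open>The normal cone of any nonempty subset of a polytope is an intersection of normal cones of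
  vertices, and conversely every such intersection belongs to the normal fan. By the rearrangement
  inequality, the normal cone of \<open>\<O>(p)\<close> at the vertex \<open>\<sigma>(p)\<close> consists of the \<open>y\<close> that are weakly
  increasing along the strict order on \<open>I\<close> given by the coordinates of \<open>\<sigma>(p)\<close>. Hence the fan depends
  only on that order up to permutations of \<open>I\<close>. Conversely, an inclusion between such cones reverses
  the orders; as all orders in one orbit have equally many pairs, equal fans force equal orders up to
  permutation. These orders are classified by the sizes of the blocks of equal coordinates, listed by
  increasing value.\<close>

section \<open>The normal fan of a convex hull of finitely many points\<close>

lemma lookup_scaleR: "Poly_Mapping.lookup (r *\<^sub>R p) i = r *\<^sub>R Poly_Mapping.lookup p i"
proof -
  have "finite {i. r *\<^sub>R Poly_Mapping.lookup p i \<noteq> 0}"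
    by (rule finite_subset[OF _ finite_lookup[of p]]) auto
  then show ?thesis by (simp add: scaleR_poly_mapping_def Abs_poly_mapping_inverse)
qed

lemma linear_pairing: "linear (pairing I y)"
  by (rule linearI) (simp_all add: pairing_def lookup_add lookup_scaleR algebra_simps sum.distrib sum_distrib_left)

lemma pairing_le_on_hull:
  assumes "\<And>v. v \<in> V \<Longrightarrow> pairing I y v \<le> M" and "x \<in> convex hull V"
  shows "pairing I y x \<le> M"
proof -
  have "convex {x. pairing I y x \<le> M}"
    using convex_linear_vimage[OF linear_pairing, of "{..M}" I y] by (simp add: vimage_def)
  then have "convex hull V \<subseteq> {x. pairing I y x \<le> M}"
    using assms(1) by (intro hull_minimal) auto
  then show ?thesis using assms(2) by auto
qed

lemma normal_cone_hull:
  "normal_cone I (convex hull V) F =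
     {y \<in> dual_space I. \<forall>x\<in>F. \<forall>v\<in>V. pairing I y v \<le> pairing I y x}"
proof -
  have "(\<forall>z\<in>convex hull V. pairing I y z \<le> M) \<longleftrightarrow> (\<forall>v\<in>V. pairing I y v \<le> M)" for y M
    by (meson hull_inc pairing_le_on_hull)
  then show ?thesis by (simp add: normal_cone_def)
qed

lemma normal_cone_eq_Inter:
  "F \<noteq> {} \<Longrightarrow> normal_cone I P F = (\<Inter>x\<in>F. normal_cone I P {x})"
  by (auto simp: normal_cone_def)

text \<open>The face of \<open>P\<close> exposed by \<open>y\<close>.\<close>

definition maximizers :: "'a set \<Rightarrow> ('a \<Rightarrow>\<^sub>0 real) set \<Rightarrow> ('a \<Rightarrow> real) \<Rightarrow> ('a \<Rightarrow>\<^sub>0 real) set" where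
  "maximizers I P y = {x \<in> P. \<forall>z\<in>P. pairing I y z \<le> pairing I y x}"

text \<open>At an inner point of a segment, the value of \<open>y\<close> is a weighted mean, with
  positive weights, of its values at the two ends. It can be maximal only if both end values
  are.\<close>

lemma maximizers_face_of:
  assumes "convex P"
  shows "maximizers I P y face_of P"
proof -
  have "convex (maximizers I P y)"
  proof (cases "maximizers I P y = {}")
    case False
    then obtain x where x: "x \<in> maximizers I P y" by auto
    then have "maximizers I P y = P \<inter> pairing I y -` {pairing I y x}"
      by (auto simp: maximizers_def intro: order.antisym)
    then show ?thesis
      using assms convex_linear_vimage[OF linear_pairing] by (metis convex_Int convex_singleton)
  qed auto
  moreover have "a \<in> maximizers I P y \<and> b \<in> maximizers I P y"
    if H: "a \<in> P" "b \<in> P" "x \<in> maximizers I P y" "x \<in> open_segment a b" for a b x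
  proof -
    obtain u where u: "0 < u" "u < 1" "x = (1 - u) *\<^sub>R a + u *\<^sub>R b"
      using H(4) by (auto simp: in_segment)
    have x: "pairing I y x = (1 - u) * pairing I y a + u * pairing I y b"
      using u(3) linear_pairing[of I y] by (simp add: linear_add linear_scale)
    have le: "pairing I y a \<le> pairing I y x" "pairing I y b \<le> pairing I y x"
      using that by (auto simp: maximizers_def)
    have "(1 - u) * (pairing I y x - pairing I y a) + u * (pairing I y x - pairing I y b) = 0"
      using x by (simp add: algebra_simps)
    moreover have "0 \<le> (1 - u) * (pairing I y x - pairing I y a)"
      "0 \<le> u * (pairing I y x - pairing I y b)"
      using u le by auto
    ultimately have "(1 - u) * (pairing I y x - pairing I y a) = 0"
      "u * (pairing I y x - pairing I y b) = 0"
      by linarith+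
    then have "pairing I y a = pairing I y x" "pairing I y b = pairing I y x"
      using u by auto
    then show ?thesis using that by (auto simp: maximizers_def)
  qed
  moreover have "maximizers I P y \<subseteq> P" by (auto simp: maximizers_def)
  ultimately show ?thesis unfolding face_of_def by meson
qed

text \<open>In a convex combination that maximizes \<open>y\<close>, every point of positive weight
  maximizes \<open>y\<close>. Hence the maximal points of \<open>V\<close> decide whether
  \<open>x\<close> also maximizes \<open>z\<close>.\<close>

lemma maximizer_on_hull:
  assumes "finite V" and x: "x \<in> maximizers I (convex hull V) y"
    and z: "V \<inter> maximizers I (convex hull V) y \<subseteq> maximizers I (convex hull V) z"
  shows "V \<inter> maximizers I (convex hull V) y \<noteq> {}" and "x \<in> maximizers I (convex hull V) z"
proof -
  obtain u where u: "\<And>v. v \<in> V \<Longrightarrow> 0 \<le> u v" "sum u V = 1" "x = (\<Sum>v\<in>V. u v *\<^sub>R v)"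
    using x assms(1) by (auto simp: maximizers_def convex_hull_finite)
  have pair: "pairing I w x = (\<Sum>v\<in>V. u v * pairing I w v)" for w
    using linear_pairing[of I w] by (simp add: u(3) linear_sum linear_scale)
  \<comment> \<open>The weights sum to 1, so the weighted gaps to the maximum cancel; being
    nonnegative, each of them vanishes.\<close>
  have "(\<Sum>v\<in>V. u v * (pairing I y x - pairing I y v)) = 0"
    by (simp add: algebra_simps sum_subtractf pair flip: sum_distrib_right sum_distrib_left)
       (simp add: u(2) flip: pair)
  moreover have le: "pairing I y v \<le> pairing I y x" if "v \<in> V" for v
    using x that by (auto simp: maximizers_def hull_inc)
  ultimately have "\<forall>v\<in>V. u v * (pairing I y x - pairing I y v) = 0"
    using assms(1) u(1) by (subst (asm) sum_nonneg_eq_0_iff) auto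
  then have supp: "v \<in> V \<inter> maximizers I (convex hull V) y" if "v \<in> V" "u v \<noteq> 0" for v
    using that x by (auto simp: maximizers_def hull_inc)
  show "V \<inter> maximizers I (convex hull V) y \<noteq> {}"
  proof
    assume "V \<inter> maximizers I (convex hull V) y = {}"
    then have "sum u V = 0" using supp by (intro sum.neutral) blast
    then show False using u(2) by simp
  qed
  then obtain m where m: "m \<in> V" "m \<in> maximizers I (convex hull V) z"
    using z by auto
  have "u v * pairing I z v = u v * pairing I z m" if "v \<in> V" for v
  proof (cases "u v = 0")
    case False
    then have "v \<in> maximizers I (convex hull V) z" using supp z that by auto
    then have "pairing I z v = pairing I z m"
      using m by (auto simp: maximizers_def intro: order.antisym)
    then show ?thesis by simp
  qed auto
  then have "pairing I z x = (\<Sum>v\<in>V. u v * pairing I z m)"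
    unfolding pair by (rule sum.cong[OF refl])
  then have "pairing I z x = pairing I z m"
    using u(2) by (simp flip: sum_distrib_right)
  then show "x \<in> maximizers I (convex hull V) z"
    using m x by (auto simp: maximizers_def)
qed

text \<open>A functional in the normal cone with as few maximal vertices as possible lies in its relative
  interior; this avoids showing that faces are exposed.\<close>

lemma normal_cone_eq_maximizers:
  fixes V :: "('a \<Rightarrow>\<^sub>0 real) set"
  assumes "finite V" and F: "F \<subseteq> convex hull V" "F \<noteq> {}"
  defines "P \<equiv> convex hull V"
  obtains y where "F \<subseteq> maximizers I P y" "V \<inter> maximizers I P y \<noteq> {}"
    "normal_cone I P F = normal_cone I P (maximizers I P y)"
    "normal_cone I P F = normal_cone I P (V \<inter> maximizers I P y)"
proof -
  have cone_iff: "y \<in> normal_cone I P G \<longleftrightarrow> y \<in> dual_space I \<and> G \<subseteq> maximizers I P y"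
    if "G \<subseteq> P" for G y
    using that by (auto simp: normal_cone_def maximizers_def)
  \<comment> \<open>The zero functional makes the cone nonempty, so a member with fewest maximal
    points in \<open>V\<close> exists. The restricted lambda keeps it extensional.\<close>
  have "(\<lambda>i\<in>I. 0) \<in> normal_cone I P F"
    by (auto simp: normal_cone_def dual_space_def pairing_def)
  then obtain y where y: "y \<in> normal_cone I P F"
    and min: "\<And>z. z \<in> normal_cone I P F \<Longrightarrow>
      card (V \<inter> maximizers I P y) \<le> card (V \<inter> maximizers I P z)"
    using ex_has_least_nat[of "\<lambda>y. y \<in> normal_cone I P F" _ "\<lambda>y. card (V \<inter> maximizers I P y)"]
    by blast
  have FP: "F \<subseteq> P" using F by (simp add: P_def)
  have Fy: "F \<subseteq> maximizers I P y" using y cone_iff[OF FP] by auto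
  obtain x where x: "x \<in> F" using F(2) by auto
  have ne: "V \<inter> maximizers I P y \<noteq> {}"
    using maximizer_on_hull(1)[of V x I y y] assms(1) Fy x by (auto simp: P_def)
  have sub: "V \<inter> maximizers I P y \<subseteq> maximizers I P z" if z: "z \<in> normal_cone I P F" for z
  proof -
    \<comment> \<open>The sum of two functionals that are both maximal at \<open>x\<close> is
      maximal only where both are. So \<open>w\<close> has no more maximal points in
      \<open>V\<close> than \<open>y\<close>, and minimality of \<open>y\<close> forces the same
      ones; these then maximize \<open>z\<close> too.\<close>
    define w where "w = (\<lambda>i\<in>I. y i + z i)"
    have pw: "pairing I w v = pairing I y v + pairing I z v" for v
      by (simp add: w_def pairing_def algebra_simps sum.distrib)
    have "w \<in> normal_cone I P F"
      using y z by (auto simp: normal_cone_def pw intro: add_mono)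
        (auto simp: dual_space_def w_def)
    then have card: "card (V \<inter> maximizers I P y) \<le> card (V \<inter> maximizers I P w)" by (rule min)
    have xy: "x \<in> maximizers I P y" "x \<in> maximizers I P z"
      using x y z cone_iff[OF FP] by auto
    have "v \<in> maximizers I P y \<and> v \<in> maximizers I P z" if "v \<in> maximizers I P w" for v
    proof -
      have "pairing I y v \<le> pairing I y x" "pairing I z v \<le> pairing I z x"
        "pairing I w x \<le> pairing I w v"
        using xy that by (auto simp: maximizers_def)
      then have "pairing I y v = pairing I y x" "pairing I z v = pairing I z x"
        by (auto simp: pw)
      then show ?thesis using xy that by (auto simp: maximizers_def)
    qed
    then have "V \<inter> maximizers I P w \<subseteq> V \<inter> maximizers I P y"
      "maximizers I P w \<subseteq> maximizers I P z" by auto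
    moreover from this(1) card have "V \<inter> maximizers I P w = V \<inter> maximizers I P y"
      using assms(1) by (intro card_subset_eq) (auto intro: order.antisym card_mono)
    ultimately show ?thesis by auto
  qed
  have MP: "maximizers I P y \<subseteq> P" by (auto simp: maximizers_def)
  have VP: "V \<inter> maximizers I P y \<subseteq> P" using MP by auto
  have hull: "maximizers I P y \<subseteq> maximizers I P z"
    if "V \<inter> maximizers I P y \<subseteq> maximizers I P z" for z
    using that maximizer_on_hull(2)[of V _ I y z] assms(1) by (auto simp: P_def)
  have "normal_cone I P F = normal_cone I P (maximizers I P y)"
    unfolding set_eq_iff cone_iff[OF FP] cone_iff[OF MP]
    using sub hull Fy cone_iff[OF FP] by blast
  moreover have "normal_cone I P F = normal_cone I P (V \<inter> maximizers I P y)"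
    unfolding set_eq_iff cone_iff[OF FP] cone_iff[OF VP]
    using sub hull Fy cone_iff[OF FP] by blast
  ultimately show thesis using that Fy ne by blast
qed

text \<open>This removes faces from the description of the fan. A face has the same cone as the
  points of \<open>V\<close> on some exposed face containing it; conversely, a nonempty
  \<open>S\<close> in \<open>V\<close> has the same cone as an exposed face containing
  \<open>S\<close>.\<close>

lemma normal_fan_hull:
  fixes V :: "('a \<Rightarrow>\<^sub>0 real) set"
  assumes "finite V"
  defines "P \<equiv> convex hull V"
  shows "normal_fan I P = {\<Inter>K |K. K \<subseteq> (\<lambda>v. normal_cone I P {v}) ` V \<and> K \<noteq> {}}"
proof (intro equalityI subsetI)
  fix C assume "C \<in> normal_fan I P"
  then obtain F where F: "F face_of P" "F \<noteq> {}" "C = normal_cone I P F"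
    by (auto simp: normal_fan_def)
  obtain y where y: "V \<inter> maximizers I P y \<noteq> {}"
      "normal_cone I P F = normal_cone I P (V \<inter> maximizers I P y)"
    using normal_cone_eq_maximizers[of V F I] assms F face_of_imp_subset[OF F(1)]
    by (metis P_def)
  have "C = \<Inter>((\<lambda>v. normal_cone I P {v}) ` (V \<inter> maximizers I P y))"
    using F(3) y normal_cone_eq_Inter by metis
  then show "C \<in> {\<Inter>K |K. K \<subseteq> (\<lambda>v. normal_cone I P {v}) ` V \<and> K \<noteq> {}}"
    using y(1) by blast
next
  fix C assume "C \<in> {\<Inter>K |K. K \<subseteq> (\<lambda>v. normal_cone I P {v}) ` V \<and> K \<noteq> {}}"
  then obtain S where S: "S \<subseteq> V" "S \<noteq> {}" "C = (\<Inter>v\<in>S. normal_cone I P {v})"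
    by (auto simp: subset_image_iff)
  then have C: "C = normal_cone I P S" using normal_cone_eq_Inter by metis
  have "S \<subseteq> convex hull V" using S(1) hull_subset[of V convex] by (rule order_trans)
  then obtain y where "S \<subseteq> maximizers I P y"
      "normal_cone I P S = normal_cone I P (maximizers I P y)"
    using normal_cone_eq_maximizers[OF assms(1) _ S(2), of I] unfolding P_def by metis
  then show "C \<in> normal_fan I P"
    using S(2) C maximizers_face_of[of P I y] convex_convex_hull[of V]
    unfolding normal_fan_def P_def by blast
qed

section \<open>The normal fan of an orbit polytope\<close>

text \<open>Induction on the size of \<open>I\<close>: some \<open>m\<close> maximizes
  \<open>x\<close> and \<open>y\<close> at once. Redirecting \<open>\<tau>\<close> so that it fixes
  \<open>m\<close> does not decrease the sum, and then \<open>m\<close> can be removed.\<close>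

lemma rearrangement_le:
  fixes x y :: "'a \<Rightarrow> real"
  assumes "finite I" and "\<tau> permutes I"
    and "\<And>i j. i \<in> I \<Longrightarrow> j \<in> I \<Longrightarrow> x i < x j \<Longrightarrow> y i \<le> y j"
  shows "(\<Sum>i\<in>I. y i * x (\<tau> i)) \<le> (\<Sum>i\<in>I. y i * x i)"
  using assms
proof (induction "card I" arbitrary: I \<tau>)
  case 0
  then show ?case by simp
next
  case (Suc k)
  then have "I \<noteq> {}" by auto
  \<comment> \<open>Ties in \<open>x\<close> put no condition on \<open>y\<close>, so
    \<open>m\<close> is chosen with the largest \<open>y\<close> among all maximal points of
    \<open>x\<close>.\<close>
  define J where "J = {i \<in> I. \<forall>j\<in>I. x j \<le> x i}"
  have "Max (x ` I) \<in> x ` I" using Suc.prems \<open>I \<noteq> {}\<close> by simp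
  then obtain i0 where "i0 \<in> I" "x i0 = Max (x ` I)" by auto
  then have J: "finite J" "J \<noteq> {}" using Suc.prems(1) by (auto simp: J_def)
  then have "Max (y ` J) \<in> y ` J" by simp
  then obtain m where m: "m \<in> J" "y m = Max (y ` J)" by auto
  have mI: "m \<in> I" and xm: "\<And>i. i \<in> I \<Longrightarrow> x i \<le> x m" using m(1) by (auto simp: J_def)
  have ym: "y i \<le> y m" if "i \<in> I" for i
  proof (cases "x i < x m")
    case True
    then show ?thesis using Suc.prems(3) that mI by auto
  next
    case False
    then have "x i = x m" using xm[OF that] by simp
    then have "i \<in> J" using that xm by (simp add: J_def)
    then show ?thesis using m(2) J by simp
  qed
  define a where "a = inv \<tau> m"
  have \<tau>a: "\<tau> a = m" using Suc.prems(2) by (simp add: a_def permutes_inverses)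
  have aI: "a \<in> I" using \<tau>a mI Suc.prems(2) by (metis permutes_in_image)
  define \<rho> where "\<rho> = \<tau> \<circ> Transposition.transpose m a"
  have "\<rho> permutes I"
    unfolding \<rho>_def using mI aI Suc.prems(2) by (intro permutes_compose permutes_swap_id)
  moreover have \<rho>m: "\<rho> m = m" by (simp add: \<rho>_def \<tau>a)
  ultimately have \<rho>: "\<rho> permutes I - {m}"
    by (metis permutes_superset Diff_iff singletonD)
  have IH: "(\<Sum>i\<in>I-{m}. y i * x (\<rho> i)) \<le> (\<Sum>i\<in>I-{m}. y i * x i)"
    using Suc.hyps(2) Suc.prems mI \<rho> by (intro Suc.hyps(1)) auto
  have "(\<Sum>i\<in>I. y i * x (\<tau> i)) \<le> (\<Sum>i\<in>I. y i * x (\<rho> i))"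
  proof (cases "a = m")
    case True
    then show ?thesis by (simp add: \<rho>_def)
  next
    case False
    have split: "sum f I = f m + (f a + sum f (I - {m} - {a}))" for f :: "'a \<Rightarrow> real"
      using Suc.prems(1) mI aI False by (simp add: sum.remove)
    have "(\<Sum>i\<in>I-{m}-{a}. y i * x (\<tau> i)) = (\<Sum>i\<in>I-{m}-{a}. y i * x (\<rho> i))"
      by (intro sum.cong) (auto simp: \<rho>_def transpose_def)
    \<comment> \<open>This product is exactly the gain in passing from \<open>\<tau>\<close> to
      \<open>\<rho>\<close>, as \<open>\<rho>\<close> sends \<open>m\<close> to \<open>m\<close> and
      \<open>a\<close> to \<open>\<tau> m\<close>.\<close>
    moreover have "0 \<le> (y m - y a) * (x m - x (\<tau> m))"
      using ym[OF aI] xm[of "\<tau> m"] mI Suc.prems(2) by (simp add: permutes_in_image)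
    ultimately show ?thesis
      using False by (simp add: split \<rho>m \<tau>a algebra_simps) (simp add: \<rho>_def algebra_simps)
  qed
  also have "\<dots> \<le> (\<Sum>i\<in>I. y i * x i)"
    using IH Suc.prems(1) mI by (simp add: sum.remove \<rho>m)
  finally show ?case .
qed

text \<open>For injective \<open>x\<close> on \<open>I\<close> this is a closed chamber of the braid
  arrangement; for constant \<open>x\<close> it is the whole dual space.\<close>

definition order_cone :: "'a set \<Rightarrow> ('a \<Rightarrow> real) \<Rightarrow> ('a \<Rightarrow> real) set" where
  "order_cone I x = {y \<in> dual_space I. \<forall>i\<in>I. \<forall>j\<in>I. x i < x j \<longrightarrow> y i \<le> y j}"

text \<open>Comparing the vertex with the points obtained by swapping two of its coordinates already
  yields all the inequalities; the rearrangement inequality shows that they suffice.\<close>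

lemma normal_cone_vertex:
  assumes "finite I" and "\<sigma> permutes I"
  shows "normal_cone I (orbit_polytope I p) {perm_act \<sigma> p} =
           order_cone I (Poly_Mapping.lookup p \<circ> inv \<sigma>)"
proof -
  let ?x = "Poly_Mapping.lookup p \<circ> inv \<sigma>"
  have pair: "pairing I y (perm_act \<tau> p) = (\<Sum>i\<in>I. y i * Poly_Mapping.lookup p (inv \<tau> i))"
    if "\<tau> permutes I" for \<tau> y
    using that by (simp add: pairing_def lookup_perm_act)
  have max_iff: "(\<forall>v\<in>{perm_act \<tau> p |\<tau>. \<tau> permutes I}. pairing I y v \<le> pairing I y (perm_act \<sigma> p))
      \<longleftrightarrow> (\<forall>i\<in>I. \<forall>j\<in>I. ?x i < ?x j \<longrightarrow> y i \<le> y j)" for y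
  proof (intro iffI ballI impI)
    fix i j
    assume max: "\<forall>v\<in>{perm_act \<tau> p |\<tau>. \<tau> permutes I}. pairing I y v \<le> pairing I y (perm_act \<sigma> p)"
      and ij: "i \<in> I" "j \<in> I" "?x i < ?x j"
    \<comment> \<open>This permutation yields the vertex with coordinates \<open>i\<close> and
      \<open>j\<close> exchanged.\<close>
    define \<tau> where "\<tau> = Transposition.transpose i j \<circ> \<sigma>"
    have \<tau>: "\<tau> permutes I"
      unfolding \<tau>_def using ij assms(2) by (intro permutes_compose permutes_swap_id)
    have inv: "inv \<tau> = inv \<sigma> \<circ> Transposition.transpose i j"
      unfolding \<tau>_def using assms(2)
      by (simp add: o_inv_distrib permutes_bij inv_unique_comp)
    have "pairing I y (perm_act \<tau> p) \<le> pairing I y (perm_act \<sigma> p)" using max \<tau> by blast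
    then have le: "(\<Sum>k\<in>I. y k * ?x (Transposition.transpose i j k)) \<le> (\<Sum>k\<in>I. y k * ?x k)"
      using \<tau> assms(2) by (simp add: pair inv)
    have "i \<noteq> j" using ij by auto
    then have split: "sum f I = f i + (f j + sum f (I - {i} - {j}))" for f :: "'a \<Rightarrow> real"
      using assms(1) ij by (simp add: sum.remove)
    have "(\<Sum>k\<in>I-{i}-{j}. y k * ?x (Transposition.transpose i j k)) = (\<Sum>k\<in>I-{i}-{j}. y k * ?x k)"
      by (intro sum.cong) (auto simp: transpose_def)
    with le have "0 \<le> (y j - y i) * (?x j - ?x i)"
      unfolding split by (simp add: algebra_simps)
    then show "y i \<le> y j" using ij(3) by (simp add: zero_le_mult_iff)
  next
    fix v assume mono: "\<forall>i\<in>I. \<forall>j\<in>I. ?x i < ?x j \<longrightarrow> y i \<le> y j"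
      and "v \<in> {perm_act \<tau> p |\<tau>. \<tau> permutes I}"
    then obtain \<tau> where \<tau>: "\<tau> permutes I" "v = perm_act \<tau> p" by auto
    \<comment> \<open>The coordinates of \<open>perm_act \<tau> p\<close> are those of
      \<open>perm_act \<sigma> p\<close> rearranged by this permutation.\<close>
    have "\<sigma> \<circ> inv \<tau> permutes I"
      using assms(2) \<tau>(1) by (intro permutes_compose permutes_inv)
    from rearrangement_le[OF assms(1) this, of ?x y]
    have "(\<Sum>i\<in>I. y i * ?x ((\<sigma> \<circ> inv \<tau>) i)) \<le> (\<Sum>i\<in>I. y i * ?x i)"
      using mono by blast
    then show "pairing I y v \<le> pairing I y (perm_act \<sigma> p)"
      using \<tau> assms(2) by (simp add: pair permutes_inverses)
  qed
  show ?thesis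
    unfolding orbit_polytope_def normal_cone_hull order_cone_def using max_iff by simp
qed

lemma normal_fan_orbit_polytope:
  assumes "finite I"
  shows "normal_fan I (orbit_polytope I p) =
    {\<Inter>K |K. K \<subseteq> {order_cone I (Poly_Mapping.lookup p \<circ> \<sigma>) |\<sigma>. \<sigma> permutes I} \<and> K \<noteq> {}}"
proof -
  let ?V = "{perm_act \<sigma> p |\<sigma>. \<sigma> permutes I}"
  have "finite ?V"
    using finite_permutations[OF assms] by (simp add: setcompr_eq_image)
  moreover have "(\<lambda>v. normal_cone I (orbit_polytope I p) {v}) ` ?V =
      {order_cone I (Poly_Mapping.lookup p \<circ> \<sigma>) |\<sigma>. \<sigma> permutes I}"
  proof -
    have "(\<lambda>v. normal_cone I (orbit_polytope I p) {v}) ` ?V =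
        (\<lambda>\<sigma>. order_cone I (Poly_Mapping.lookup p \<circ> inv \<sigma>)) ` {\<sigma>. \<sigma> permutes I}"
      using normal_cone_vertex[OF assms] by (auto simp: image_iff)
    also have "\<dots> = (\<lambda>\<sigma>. order_cone I (Poly_Mapping.lookup p \<circ> \<sigma>)) ` inv ` {\<sigma>. \<sigma> permutes I}"
      by (simp add: image_image)
    \<comment> \<open>Inversion is a bijection of the group, so the inverses in the action disappear
      from the description of the fan.\<close>
    also have "inv ` {\<sigma>. \<sigma> permutes I} = {\<sigma>. \<sigma> permutes I}"
      by (auto simp: image_iff permutes_inv) (metis permutes_inv permutes_inv_inv)
    finally show ?thesis by (simp only: setcompr_eq_image)
  qed
  ultimately show ?thesis
    using normal_fan_hull[of ?V I] by (simp add: orbit_polytope_def)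
qed

section \<open>Recovering the strict order, up to permutation, from the fan\<close>

lemma order_cone_subsetD:
  assumes "order_cone I p \<subseteq> order_cone I q" and "i \<in> I" "j \<in> I" "q i < q j"
  shows "p i < p j"
proof (rule ccontr)
  assume "\<not> p i < p j"
  \<comment> \<open>The indicator of \<open>i\<close> and everything strictly above \<open>i\<close>
    under \<open>p\<close>. This set is closed upwards, so \<open>z\<close> lies in the cone of
    \<open>p\<close>, yet it would separate \<open>i\<close> from \<open>j\<close> in the wrong
    direction.\<close>
  define z :: "'a \<Rightarrow> real" where "z = (\<lambda>k\<in>I. if p i < p k \<or> k = i then 1 else 0)"
  have "z \<in> order_cone I p"
    by (auto simp: order_cone_def z_def dual_space_def)
  then have "z i \<le> z j"
    using assms by (auto simp: order_cone_def)
  then show False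
    using assms \<open>\<not> p i < p j\<close> by (auto simp: z_def split: if_splits)
qed

definition same_order :: "'a set \<Rightarrow> ('a \<Rightarrow> real) \<Rightarrow> ('a \<Rightarrow> real) \<Rightarrow> bool" where
  "same_order I p q \<longleftrightarrow> (\<forall>i\<in>I. \<forall>j\<in>I. p i < p j \<longleftrightarrow> q i < q j)"

lemma same_order_permute:
  "same_order I p q \<Longrightarrow> \<sigma> permutes I \<Longrightarrow> same_order I (p \<circ> \<sigma>) (q \<circ> \<sigma>)"
  by (auto simp: same_order_def permutes_in_image)

text \<open>The cone of \<open>p\<close> at \<open>\<tau>\<close> is that of \<open>q\<close> at
  \<open>\<sigma> \<circ> \<tau>\<close>, and left multiplication by \<open>\<sigma>\<close>
  permutes the group. Both fans thus arise from the same set of cones.\<close>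

lemma normal_fan_eq_if_same_order:
  assumes "finite I" "\<sigma> permutes I"
    and "same_order I (Poly_Mapping.lookup p) (Poly_Mapping.lookup q \<circ> \<sigma>)"
  shows "normal_fan I (orbit_polytope I p) = normal_fan I (orbit_polytope I q)"
proof -
  let ?p = "Poly_Mapping.lookup p" and ?q = "Poly_Mapping.lookup q"
  have cone: "order_cone I (?p \<circ> \<tau>) = order_cone I (?q \<circ> (\<sigma> \<circ> \<tau>))" if "\<tau> permutes I" for \<tau>
    using same_order_permute[OF assms(3) that]
    by (auto simp: order_cone_def same_order_def)
  have "{order_cone I (?p \<circ> \<tau>) |\<tau>. \<tau> permutes I} =
      (\<lambda>\<tau>. order_cone I (?q \<circ> \<tau>)) ` ((\<circ>) \<sigma> ` {\<tau>. \<tau> permutes I})"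
    using cone by (auto simp: image_iff)
  also have "(\<circ>) \<sigma> ` {\<tau>. \<tau> permutes I} = {\<tau>. \<tau> permutes I}"
    using image_compose_permutations_left[OF assms(2)] by (simp add: setcompr_eq_image)
  also have "(\<lambda>\<tau>. order_cone I (?q \<circ> \<tau>)) ` {\<tau>. \<tau> permutes I} =
      {order_cone I (?q \<circ> \<tau>) |\<tau>. \<tau> permutes I}" by auto
  finally show ?thesis
    by (simp only: normal_fan_orbit_polytope[OF assms(1)])
qed

lemma same_order_if_normal_fan_eq:
  assumes "finite I"
    and eq: "normal_fan I (orbit_polytope I p) = normal_fan I (orbit_polytope I q)"
  obtains \<sigma> where "\<sigma> permutes I"
    "same_order I (Poly_Mapping.lookup p) (Poly_Mapping.lookup q \<circ> \<sigma>)"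
proof -
  \<comment> \<open>The strict order as a finite set of pairs, so that an inclusion between orders
    can be turned into an equality by counting.\<close>
  define R where "R x = {(i, j) \<in> I \<times> I. x i < x j}" for x :: "'a \<Rightarrow> real"
  have fin: "finite (R x)" for x
    by (rule finite_subset[of _ "I \<times> I"]) (auto simp: R_def assms(1))
  have card: "card (R (x \<circ> \<tau>)) = card (R x)" if \<tau>: "\<tau> permutes I" for x \<tau>
  proof (rule bij_betw_same_card[of "map_prod \<tau> \<tau>"])
    have "R x \<subseteq> map_prod \<tau> \<tau> ` R (x \<circ> \<tau>)"
    proof
      fix e assume "e \<in> R x"
      then have "(inv \<tau> (fst e), inv \<tau> (snd e)) \<in> R (x \<circ> \<tau>)"
        using \<tau> by (auto simp: R_def permutes_inverses permutes_in_image permutes_inv)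
      then show "e \<in> map_prod \<tau> \<tau> ` R (x \<circ> \<tau>)"
        using \<tau> by (force simp: permutes_inverses)
    qed
    then show "bij_betw (map_prod \<tau> \<tau>) (R (x \<circ> \<tau>)) (R x)"
      using \<tau> by (auto simp: bij_betw_def R_def permutes_in_image intro!: inj_onI
          dest: permutes_inj[THEN injD])
  qed
  \<comment> \<open>The cone of \<open>p'\<close> is an intersection of cones of \<open>q'\<close>,
    hence contained in one of them; inclusion of cones reverses the inclusion of orders.\<close>
  have sub: "\<exists>\<sigma>. \<sigma> permutes I \<and> R (Poly_Mapping.lookup q' \<circ> \<sigma>) \<subseteq> R (Poly_Mapping.lookup p')"
    if eq: "normal_fan I (orbit_polytope I p') = normal_fan I (orbit_polytope I q')"
    for p' q' :: "'a \<Rightarrow>\<^sub>0 real"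
  proof -
    have "order_cone I (Poly_Mapping.lookup p') \<in> normal_fan I (orbit_polytope I p')"
      unfolding normal_fan_orbit_polytope[OF assms(1)]
      by (rule CollectI, rule exI[of _ "{order_cone I (Poly_Mapping.lookup p')}"])
        (auto intro!: exI[of _ id] simp: permutes_id)
    then have "order_cone I (Poly_Mapping.lookup p') \<in>
        {\<Inter>K |K. K \<subseteq> {order_cone I (Poly_Mapping.lookup q' \<circ> \<sigma>) |\<sigma>. \<sigma> permutes I} \<and> K \<noteq> {}}"
      unfolding eq by (simp only: normal_fan_orbit_polytope[OF assms(1)])
    then obtain K where K: "order_cone I (Poly_Mapping.lookup p') = \<Inter>K" "K \<noteq> {}"
      "K \<subseteq> {order_cone I (Poly_Mapping.lookup q' \<circ> \<sigma>) |\<sigma>. \<sigma> permutes I}"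
      unfolding mem_Collect_eq by (elim exE conjE)
    then obtain \<sigma> where \<sigma>: "\<sigma> permutes I" "order_cone I (Poly_Mapping.lookup q' \<circ> \<sigma>) \<in> K"
      by blast
    then have "order_cone I (Poly_Mapping.lookup p') \<subseteq> order_cone I (Poly_Mapping.lookup q' \<circ> \<sigma>)"
      unfolding K(1) by (intro Inter_lower)
    note order_cone_subsetD[OF this]
    with \<sigma>(1) show ?thesis
      by (intro exI[of _ \<sigma>]) (auto simp: R_def)
  qed
  obtain \<sigma> where \<sigma>: "\<sigma> permutes I" "R (Poly_Mapping.lookup q \<circ> \<sigma>) \<subseteq> R (Poly_Mapping.lookup p)"
    using sub[OF eq] by auto
  obtain \<tau> where \<tau>: "\<tau> permutes I" "R (Poly_Mapping.lookup p \<circ> \<tau>) \<subseteq> R (Poly_Mapping.lookup q)"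
    using sub[OF eq[symmetric]] by auto
  \<comment> \<open>The reverse comparison supplies only this bound, which makes the inclusion
    obtained for \<open>\<sigma>\<close> an equality.\<close>
  have "card (R (Poly_Mapping.lookup p)) \<le> card (R (Poly_Mapping.lookup q))"
    using card_mono[OF fin \<tau>(2)] card[OF \<tau>(1)] by simp
  then have "R (Poly_Mapping.lookup q \<circ> \<sigma>) = R (Poly_Mapping.lookup p)"
    using \<sigma> card[OF \<sigma>(1)] card_seteq[OF fin \<sigma>(2)] by simp
  then have "same_order I (Poly_Mapping.lookup p) (Poly_Mapping.lookup q \<circ> \<sigma>)"
    by (auto simp: R_def same_order_def set_eq_iff)
  then show thesis using that \<sigma>(1) by blast
qed

section \<open>The composition of a point\<close>

text \<open>Distinct values are counted rather than points, so that the ranks run through 0, 1, 2,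
  ... without gaps and can index a list of blocks.\<close>

definition value_rank :: "'a set \<Rightarrow> ('a \<Rightarrow> real) \<Rightarrow> 'a \<Rightarrow> nat" where
  "value_rank I p i = card {t \<in> p ` I. t < p i}"

definition block_sizes :: "'a set \<Rightarrow> ('a \<Rightarrow> real) \<Rightarrow> nat list" where
  "block_sizes I p = map (\<lambda>k. card {i \<in> I. value_rank I p i = k}) [0..<card (p ` I)]"

lemma value_rank_less_iff:
  assumes "finite I" "i \<in> I" "j \<in> I"
  shows "value_rank I p i < value_rank I p j \<longleftrightarrow> p i < p j"
proof -
  have "value_rank I p i < value_rank I p j" if "p i < p j" "i \<in> I" for i j
    unfolding value_rank_def using assms(1) that by (intro psubset_card_mono) auto
  moreover have "value_rank I p j \<le> value_rank I p i" if "p j \<le> p i" for i j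
    unfolding value_rank_def using assms(1) that by (intro card_mono) auto
  ultimately show ?thesis using assms by (meson not_le)
qed

text \<open>The rank is injective on values and smaller than the number of values, so by counting it
  attains every such number.\<close>

lemma value_rank_image:
  assumes "finite I"
  shows "value_rank I p ` I = {..<card (p ` I)}"
proof (rule card_subset_eq)
  show "value_rank I p ` I \<subseteq> {..<card (p ` I)}"
    using assms by (auto simp: value_rank_def intro!: psubset_card_mono)
  have "inj_on (\<lambda>t. card {s \<in> p ` I. s < t}) (p ` I)"
  proof (rule linorder_inj_onI')
    fix s t assume "s \<in> p ` I" "t \<in> p ` I" "s < t"
    then have "card {r \<in> p ` I. r < s} < card {r \<in> p ` I. r < t}"
      using assms by (intro psubset_card_mono) auto
    then show "card {r \<in> p ` I. r < s} \<noteq> card {r \<in> p ` I. r < t}" by simp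
  qed
  then have "card ((\<lambda>t. card {s \<in> p ` I. s < t}) ` p ` I) = card (p ` I)"
    by (rule card_image)
  then show "card (value_rank I p ` I) = card {..<card (p ` I)}"
    by (simp add: image_image value_rank_def[abs_def])
qed auto

lemma block_sizes_composition:
  assumes "finite I"
  shows "block_sizes I p \<in> compositions (card I)"
proof -
  have "sum_list (block_sizes I p) = (\<Sum>k<card (p ` I). card {i \<in> I. value_rank I p i = k})"
    by (simp add: block_sizes_def interv_sum_list_conv_sum_set_nat atLeast0LessThan)
  also have "\<dots> = card I"
    using sum.image_gen[OF assms, of "\<lambda>_. 1::nat" "value_rank I p"] value_rank_image[OF assms, of p]
    by simp
  finally have "sum_list (block_sizes I p) = card I" .
  moreover have "0 < card {i \<in> I. value_rank I p i = k}" if "k < card (p ` I)" for k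
  proof -
    have "k \<in> value_rank I p ` I" using value_rank_image[OF assms] that by simp
    then show ?thesis using assms by (auto simp: card_gt_0_iff)
  qed
  ultimately show ?thesis by (auto simp: compositions_def block_sizes_def)
qed


lemma image_permutes:
  "\<sigma> permutes I \<Longrightarrow> (\<lambda>i. p (\<sigma> i)) ` I = p ` I"
  by (metis image_image permutes_image)

lemma value_rank_permute:
  "\<sigma> permutes I \<Longrightarrow> value_rank I (p \<circ> \<sigma>) = value_rank I p \<circ> \<sigma>"
  by (auto simp: value_rank_def fun_eq_iff image_permutes)

text \<open>Equal strict orders have equal ties, so sending the value of \<open>p\<close> at a point
  to the value of \<open>q\<close> there is a well-defined bijection; \<open>inv_into\<close>
  selects the point.\<close>

lemma card_image_same_order:
  assumes "finite I" "same_order I p q" "J \<subseteq> I"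
  shows "card (p ` J) = card (q ` J)"
proof -
  have eq_iff: "p i = p j \<longleftrightarrow> q i = q j" if "i \<in> I" "j \<in> I" for i j
    using assms(2) that unfolding same_order_def by (metis linorder_neq_iff)
  have "\<exists>i\<in>J. p i = p j \<and> inv_into J p (p j) = i" if "j \<in> J" for j
    using that by (metis f_inv_into_f imageI inv_into_into)
  then have "q (inv_into J p (p j)) = q j" if "j \<in> J" for j
    using that eq_iff assms(3) by (metis subsetD)
  then have "(\<lambda>t. q (inv_into J p t)) ` (p ` J) = q ` J"
    by (force simp: image_image)
  moreover have "inj_on (\<lambda>t. q (inv_into J p t)) (p ` J)"
    using \<open>\<And>j. j \<in> J \<Longrightarrow> q (inv_into J p (p j)) = q j\<close>
    by (auto intro!: inj_onI simp: eq_iff subsetD[OF assms(3)])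
  ultimately show ?thesis by (metis card_image)
qed

lemma block_sizes_same_order:
  assumes "finite I" "same_order I p q"
  shows "block_sizes I p = block_sizes I q"
proof -
  have "value_rank I p i = value_rank I q i" if "i \<in> I" for i
  proof -
    have "{t \<in> x ` I. t < x i} = x ` {j \<in> I. x j < x i}" for x :: "'a \<Rightarrow> real"
      by auto
    moreover have "{j \<in> I. p j < p i} = {j \<in> I. q j < q i}"
      using assms(2) that by (auto simp: same_order_def)
    ultimately show ?thesis
      unfolding value_rank_def using card_image_same_order[OF assms, of "{j \<in> I. p j < p i}"] by auto
  qed
  then have "{i \<in> I. value_rank I p i = k} = {i \<in> I. value_rank I q i = k}" for k by auto
  then show ?thesis
    using card_image_same_order[OF assms order_refl] by (simp add: block_sizes_def)
qed

lemma block_sizes_permute: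
  assumes "\<sigma> permutes I"
  shows "block_sizes I (p \<circ> \<sigma>) = block_sizes I p"
proof -
  have "bij_betw \<sigma> {i \<in> I. value_rank I p (\<sigma> i) = k} {i \<in> I. value_rank I p i = k}" for k
    using assms by (intro bij_betw_byWitness[where f' = "inv \<sigma>"])
      (auto simp: permutes_inverses permutes_in_image permutes_inv)
  then have "card {i \<in> I. value_rank I p (\<sigma> i) = k} = card {i \<in> I. value_rank I p i = k}" for k
    by (rule bij_betw_same_card)
  moreover have "(p \<circ> \<sigma>) ` I = p ` I"
    using assms by (simp add: image_permutes)
  ultimately show ?thesis
    using assms by (simp add: block_sizes_def value_rank_permute del: o_apply) simp
qed

text \<open>Equal block sizes mean that each rank is attained equally often. The two rank functions
  then differ by a permutation of \<open>I\<close>, and ranks determine the strict order.\<close>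

lemma block_sizes_eq_iff:
  assumes "finite I"
  shows "block_sizes I p = block_sizes I q \<longleftrightarrow> (\<exists>\<sigma>. \<sigma> permutes I \<and> same_order I p (q \<circ> \<sigma>))"
proof
  assume eq: "block_sizes I p = block_sizes I q"
  have len: "card (p ` I) = card (q ` I)"
    using arg_cong[OF eq, of length] by (simp add: block_sizes_def)
  have "card {i \<in> I. value_rank I p i = k} = card {i \<in> I. value_rank I q i = k}" for k
  proof (cases "k < card (p ` I)")
    case True
    then show ?thesis
      using arg_cong[OF eq, of "\<lambda>xs. xs ! k"] len by (simp add: block_sizes_def)
  next
    case False
    \<comment> \<open>Beyond the common length of the lists no rank occurs, so both fibers are
      empty.\<close>
    have "{i \<in> I. value_rank I x i = k} = {}" if "\<not> k < card (x ` I)" for x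
      using that value_rank_image[OF assms, of x] by auto
    then show ?thesis using False len by metis
  qed
  then have "image_mset (value_rank I p) (mset_set I) = image_mset (value_rank I q) (mset_set I)"
    using assms by (intro multiset_eqI) (simp add: count_image_mset_eq_card_vimage)
  then obtain \<sigma> where \<sigma>: "\<sigma> permutes I" "\<forall>i\<in>I. value_rank I p i = value_rank I q (\<sigma> i)"
    using image_mset_eq_implies_permutes[OF assms] by metis
  have "same_order I p (q \<circ> \<sigma>)"
    unfolding same_order_def
  proof (intro ballI)
    fix i j assume "i \<in> I" "j \<in> I"
    then show "p i < p j \<longleftrightarrow> (q \<circ> \<sigma>) i < (q \<circ> \<sigma>) j"
      using \<sigma> value_rank_less_iff[OF assms, of i j p]
        value_rank_less_iff[OF assms, of "\<sigma> i" "\<sigma> j" q]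
      by (simp add: permutes_in_image)
  qed
  then show "\<exists>\<sigma>. \<sigma> permutes I \<and> same_order I p (q \<circ> \<sigma>)" using \<sigma>(1) by auto
next
  assume "\<exists>\<sigma>. \<sigma> permutes I \<and> same_order I p (q \<circ> \<sigma>)"
  then show "block_sizes I p = block_sizes I q"
    using block_sizes_same_order[OF assms] block_sizes_permute by metis
qed

section \<open>Realizing a composition by a point\<close>

lemma ex_point_with_block_sizes:
  assumes "finite I" "c \<in> compositions (card I)"
  obtains p where "p \<in> free_space I" "block_sizes I (Poly_Mapping.lookup p) = c"
proof -
  \<comment> \<open>Each block index \<open>k\<close> is repeated \<open>c ! k\<close> times, and an
    enumeration of \<open>I\<close> will turn the list into coordinates. The point is built so that
    its coordinates are its own ranks.\<close>
  define xs where "xs = concat (map (\<lambda>k. replicate (c ! k) k) [0..<length c])"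
  have "length xs = sum_list (map ((!) c) [0..<length c])"
    by (simp add: xs_def length_concat comp_def)
  then have len: "length xs = card I"
    using assms(2) by (simp add: map_nth compositions_def)
  have count: "card {m. m < length xs \<and> xs ! m = k} = (if k < length c then c ! k else 0)" for k
  proof -
    have "count_list (replicate m j) k = (if j = k then m else 0)" for m j
      by (induction m) auto
    moreover have "card {m. m < length xs \<and> xs ! m = k} = count_list xs k"
      by (simp add: count_list_eq_length_filter length_filter_conv_card eq_commute)
    moreover have "count_list xs k = (\<Sum>j<length c. count_list (replicate (c ! j) j) k)"
      by (simp add: xs_def count_list_concat comp_def interv_sum_list_conv_sum_set_nat
          atLeast0LessThan)
    ultimately show ?thesis by simp
  qed
  obtain e where e: "bij_betw e I {..<card I}"
    using assms(1) by (metis ex_bij_betw_finite_nat atLeast0LessThan)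
  define r where "r i = xs ! e i" for i
  have fiber: "card {i \<in> I. r i = k} = (if k < length c then c ! k else 0)" for k
  proof -
    have "bij_betw e {i \<in> I. r i = k} {m. m < length xs \<and> xs ! m = k}"
      using e by (auto simp: bij_betw_def r_def len inj_on_def)
    from bij_betw_same_card[OF this] show ?thesis by (simp add: count)
  qed
  have rI: "r ` I = {..<length c}"
  proof (intro equalityI subsetI)
    fix k assume "k \<in> r ` I"
    then have "card {i \<in> I. r i = k} \<noteq> 0" using assms(1) by (auto simp: card_eq_0_iff)
    then show "k \<in> {..<length c}" using fiber[of k] by (auto split: if_splits)
  next
    fix k assume "k \<in> {..<length c}"
    \<comment> \<open>Positivity of the entries enters here: an empty block would leave a gap among
      the values and shift the later ranks.\<close>
    then have "card {i \<in> I. r i = k} \<noteq> 0"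
      using fiber[of k] assms(2) by (auto simp: compositions_def)
    then have "{i \<in> I. r i = k} \<noteq> {}" by (metis card.empty)
    then show "k \<in> r ` I" by auto
  qed
  define p where "p = Abs_poly_mapping (\<lambda>i. if i \<in> I then real (r i) else 0)"
  have "finite {i. (if i \<in> I then real (r i) else 0) \<noteq> 0}"
    by (rule finite_subset[OF _ assms(1)]) auto
  then have p: "Poly_Mapping.lookup p = (\<lambda>i. if i \<in> I then real (r i) else 0)"
    by (simp add: p_def Abs_poly_mapping_inverse)
  have pI: "Poly_Mapping.lookup p ` I = real ` {..<length c}"
    by (simp add: p image_image flip: rI)
  have rank: "value_rank I (Poly_Mapping.lookup p) i = r i" if "i \<in> I" for i
  proof -
    have "r i < length c" using rI that by auto
    then have "{t \<in> real ` {..<length c}. t < real (r i)} = real ` {..<r i}" by auto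
    then show ?thesis
      unfolding value_rank_def pI using that by (simp add: p card_image)
  qed
  have "block_sizes I (Poly_Mapping.lookup p) = map (\<lambda>k. card {i \<in> I. r i = k}) [0..<length c]"
    unfolding block_sizes_def pI by (auto simp: card_image rank cong: conj_cong)
  also have "\<dots> = c"
    by (rule nth_equalityI) (simp_all add: fiber)
  finally have "block_sizes I (Poly_Mapping.lookup p) = c" .
  moreover have "p \<in> free_space I"
    by (auto simp: free_space_def in_keys_iff p split: if_splits)
  ultimately show thesis using that by blast
qed

section \<open>From a complete invariant to a bijection on classes\<close>

lemma ex_bij_betw_quotient:
  assumes "\<And>x y. x \<in> A \<Longrightarrow> y \<in> A \<Longrightarrow> E (g x) (g y) \<longleftrightarrow> c x = c y"
  shows "\<exists>f. bij_betw f (g ` A // {(P, Q). P \<in> g ` A \<and> Q \<in> g ` A \<and> E P Q}) (c ` A)"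
proof -
  let ?R = "{(P, Q). P \<in> g ` A \<and> Q \<in> g ` A \<and> E P Q}"
  \<comment> \<open>The bijection is built from invariants to classes, which avoids choosing
    representatives; it is inverted at the end.\<close>
  define h where "h b = {g x |x. x \<in> A \<and> c x = b}" for b
  have "?R `` {g x} = h (c x)" if "x \<in> A" for x
    using that assms by (auto simp: h_def)
  then have "g ` A // ?R = h ` c ` A"
    by (auto simp: quotient_def)
  moreover have "inj_on h (c ` A)"
  proof (rule inj_onI)
    fix b b' assume "b \<in> c ` A" "b' \<in> c ` A" and eq: "h b = h b'"
    then obtain x where x: "x \<in> A" "c x = b" by auto
    then have "g x \<in> h b'" using eq by (auto simp: h_def)
    then obtain y where y: "y \<in> A" "c y = b'" "g x = g y" by (auto simp: h_def)
    \<comment> \<open>Different points may have the same image under \<open>g\<close>. The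
      hypothesis for \<open>x\<close> with itself gives \<open>E (g x) (g x)\<close>, and with
      \<open>g x = g y\<close> the hypothesis for \<open>x\<close> and \<open>y\<close> gives equal
      invariants.\<close>
    then show "b = b'" using x assms[of x y] assms[of x x] by simp
  qed
  ultimately have "bij_betw h (c ` A) (g ` A // ?R)" by (simp add: bij_betw_def)
  then show ?thesis using bij_betw_inv_into by blast
qed

theorem corollary3p17:
  fixes I :: "'a set" and n :: nat
  assumes "finite I" and "n = card I"
  shows "\<exists>f. bij_betw f (orbit_polytope_classes I) (compositions n)"
proof -
  let ?c = "\<lambda>p. block_sizes I (Poly_Mapping.lookup p)"
  have eq: "normally_equivalent I (orbit_polytope I p) (orbit_polytope I q) \<longleftrightarrow> ?c p = ?c q" for p q
    unfolding normally_equivalent_def block_sizes_eq_iff[OF assms(1)]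
    using normal_fan_eq_if_same_order[OF assms(1)] same_order_if_normal_fan_eq[OF assms(1)]
    by metis
  have img: "compositions n = ?c ` free_space I"
  proof (intro equalityI subsetI)
    fix c assume "c \<in> compositions n"
    then obtain p where "p \<in> free_space I" "?c p = c"
      using ex_point_with_block_sizes[OF assms(1)] assms(2) by metis
    then show "c \<in> ?c ` free_space I" by blast
  qed (use block_sizes_composition[OF assms(1)] assms(2) in blast)
  show ?thesis
    unfolding orbit_polytope_classes_def orbit_polytopes_def img
    by (rule ex_bij_betw_quotient[where c = ?c]) (rule eq)
qed

end
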